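(* Let $n$ be an even positive integer, let $k\ge 2$, and let $A_j\in\mathbb{R}^{[j,n]}$ for $j=2,\dots,k$. Consider the polynomial system in tensor form on $\mathbb{R}^n$ $$\dot{x}=A_k x^{k-1}+A_{k-1}x^{k-2}+\cdots+A_2x .$$ This system is a Hamiltonian system with a Hamiltonian of the form $$H(x)=B_kx^k+B_{k-1}x^{k-1}+\cdots+B_2x^2,\qquad B_j\in\mathbb{R}^{[j,n]}\ \text{supersymmetric},$$ (that is, the system is $\dot{x}=J\,\frac{\partial H}{\partial x}(x)$ for some $H$ of this form) if and only if $A_k,\dots,A_2$ are all Hamiltonian cubical tensors.
   Context: $\mathbb{R}^{[k,n]}$ denotes the set of real cubical tensors of order $k$ and dimension $n$, i.e. arrays $(A_{i_1\ldots i_k})$ with $1\le i_1,\dots,i_k\le n$. For $A\in\mathbb{R}^{[k,n]}$ and $x\in\mathbb{R}^n$, $Ax^{k-1}\in\mathbb{R}^n$ is the vector with entries $(Ax^{k-1})_{i_1}=\sum_{i_2,\ldots,i_k=1}^n A_{i_1i_2\ldots i_k}x_{i_2}\cdots x_{i_k}$, and $Ax^k=\sum_{i_1,\ldots,i_k=1}^nA_{i_1\ldots i_k}x_{i_1}\cdots x_{i_k}\in\mathbb{R}$. For a matrix $R\in\mathbb{R}^{n\times n}$, the product $RA\in\mathbb{R}^{[k,n]}$ is $(RA)_{i_1i_2\ldots i_k}=\sum_{j=1}^nR_{i_1j}A_{ji_2\ldots i_k}$. A tensor is supersymmetric if its entries are invariant under every permutation of the indices. For a permutation $\sigma$ of $\{1,\dots,k\}$,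 the transpose $A^{\top_\sigma}$ is the tensor $Y$ with $Y_{i_{\sigma(1)}\ldots i_{\sigma(k)}}=A_{i_1\ldots i_k}$. For even $n=2m$, $J=\begin{pmatrix}0&I_m\\-I_m&0\end{pmatrix}\in\mathbb{R}^{n\times n}$, where $I_m$ is the $m\times m$ identity matrix. A tensor $A\in\mathbb{R}^{[k,n]}$ ($k\ge2$) is a Hamiltonian cubical tensor if $(J^\top A)^{\top_\sigma}+JA=0$ for every permutation $\sigma$ of $\{1,\dots,k\}$.
   Formalization: "Only if" is proved for A_j symmetric in their last j−1 indices (vacuous for j=2); without this it is false: n=2, A_2=0, A_3 with entries (112)=1, (121)=−1, else 0, gives the zero system, yet A_3 is not Hamiltonian. "If" is unconditional. *)

theory Defs
  imports "HOL-Analysis.Analysis" "HOL-Combinatorics.Permutations"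
begin

text \<open>A cubical tensor of order \<open>k\<close> over the index type \<open>'n\<close> is a function on multi-indices, i.e.
  lists of length \<open>k\<close>; its values on lists of any other length are never looked at, so the order
  is passed explicitly where it matters.\<close>

type_synonym 'n tensor = "'n list \<Rightarrow> real"

text \<open>\<open>tensor_vec k A x\<close> is the vector \<open>A x\<^sup>k\<^sup>-\<^sup>1\<close> and \<open>tensor_form k A x\<close> the number \<open>A x\<^sup>k\<close>.\<close>

definition tensor_vec :: "nat \<Rightarrow> 'n::finite tensor \<Rightarrow> real^'n \<Rightarrow> real^'n" where
  "tensor_vec k A x = (\<chi> i. \<Sum>js | length js = k - 1. A (i # js) * (\<Prod>j\<leftarrow>js. x $ j))"

definition tensor_form :: "nat \<Rightarrow> 'n::finite tensor \<Rightarrow> real^'n \<Rightarrow> real" where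
  "tensor_form k A x = (\<Sum>is | length is = k. A is * (\<Prod>i\<leftarrow>is. x $ i))"

definition mat_tensor :: "real^'n^'n \<Rightarrow> 'n::finite tensor \<Rightarrow> 'n tensor" where
  "mat_tensor R A = (\<lambda>is. \<Sum>j\<in>UNIV. R $ hd is $ j * A (j # tl is))"

definition supersymmetric :: "nat \<Rightarrow> 'n tensor \<Rightarrow> bool" where
  "supersymmetric k A \<longleftrightarrow>
    (\<forall>\<sigma> is. \<sigma> permutes {..<k} \<longrightarrow> length is = k \<longrightarrow> A (permute_list \<sigma> is) = A is)"

text \<open>Symmetry in all indices but the first. The map \<open>x \<mapsto> A x\<^sup>k\<^sup>-\<^sup>1\<close> only determines the part of \<open>A\<close>
  that is symmetric in this sense; e.g. for \<open>n = 2\<close>, \<open>k = 3\<close>, the tensor with \<open>A\<^sub>1\<^sub>1\<^sub>2 = 1\<close>,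
  \<open>A\<^sub>1\<^sub>2\<^sub>1 = -1\<close> and all other entries \<open>0\<close> gives the zero (hence Hamiltonian) vector field
  without being a Hamiltonian tensor. So a property of the vector field can imply a property of its
  coefficient tensors only if these are normalised to be semi-symmetric. The condition is vacuous
  for \<open>k = 2\<close>, and every Hamiltonian tensor satisfies it.\<close>

definition semi_symmetric :: "nat \<Rightarrow> 'n tensor \<Rightarrow> bool" where
  "semi_symmetric k A \<longleftrightarrow>
    (\<forall>\<sigma> i js. \<sigma> permutes {..<k - 1} \<longrightarrow> length js = k - 1 \<longrightarrow>
      A (i # permute_list \<sigma> js) = A (i # js))"

text \<open>The transpose is determined by its values on permuted multi-indices, see the lemma below.\<close>

definition tensor_transpose :: "(nat \<Rightarrow> nat) \<Rightarrow> 'n tensor \<Rightarrow> 'n tensor" where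
  "tensor_transpose \<sigma> A = (\<lambda>is. A (permute_list (inv \<sigma>) is))"

lemma tensor_transpose_permute_list:
  assumes "\<sigma> permutes {..<length is}"
  shows "tensor_transpose \<sigma> A (permute_list \<sigma> is) = A is"
proof -
  have "permute_list (inv \<sigma>) (permute_list \<sigma> is) = permute_list (\<sigma> \<circ> inv \<sigma>) is"
    using assms by (intro permute_list_compose [symmetric]) (simp add: permutes_inv)
  then show ?thesis
    using assms by (simp add: tensor_transpose_def permutes_inv_o)
qed

text \<open>The even dimension \<open>n = 2m\<close> is rendered by the index type \<open>'m + 'm\<close> with \<open>m = CARD('m)\<close>:
  \<open>Inl\<close> gives the first and \<open>Inr\<close> the last \<open>m\<close> indices, i.e. the two block rows and columns
  of \<open>J\<close>.\<close>

definition symplectic_J :: "real^('m::finite + 'm)^('m + 'm)" where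
  "symplectic_J = (\<chi> i j. case (i, j) of
      (Inl a, Inr b) \<Rightarrow> (mat 1 :: real^'m^'m) $ a $ b
    | (Inr a, Inl b) \<Rightarrow> - (mat 1 :: real^'m^'m) $ a $ b
    | _ \<Rightarrow> 0)"

definition hamiltonian_tensor :: "nat \<Rightarrow> ('m::finite + 'm) tensor \<Rightarrow> bool" where
  "hamiltonian_tensor k A \<longleftrightarrow> 2 \<le> k \<and>
    (\<forall>\<sigma>. \<sigma> permutes {..<k} \<longrightarrow> (\<forall>is. length is = k \<longrightarrow>
      tensor_transpose \<sigma> (mat_tensor (transpose symplectic_J) A) is
        + mat_tensor symplectic_J A is = 0))"

text \<open>The autonomous system \<open>x' = F x\<close> is identified with its vector field \<open>F\<close>.\<close>

definition hamiltonian_system ::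
  "(real^('m::finite + 'm) \<Rightarrow> real^('m + 'm)) \<Rightarrow> (real^('m + 'm) \<Rightarrow> real) \<Rightarrow> bool" where
  "hamiltonian_system F H \<longleftrightarrow> (\<forall>x. \<exists>g. GDERIV H x :> g \<and> F x = symplectic_J *v g)"

text \<open>The system \<open>x' = A\<^sub>k x\<^sup>k\<^sup>-\<^sup>1 + \<dots> + A\<^sub>2 x\<close> has a Hamiltonian of the form \<open>B\<^sub>k x\<^sup>k + \<dots> + B\<^sub>2 x\<^sup>2\<close>
  with supersymmetric coefficient tensors.\<close>

definition has_tensor_hamiltonian :: "nat \<Rightarrow> (nat \<Rightarrow> ('m::finite + 'm) tensor) \<Rightarrow> bool" where
  "has_tensor_hamiltonian k A \<longleftrightarrow>
    (\<exists>B. (\<forall>j\<in>{2..k}. supersymmetric j (B j)) \<and>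
      hamiltonian_system (\<lambda>x. \<Sum>j=2..k. tensor_vec j (A j) x) (\<lambda>x. \<Sum>j=2..k. tensor_form j (B j) x))"

end

theory Submission
  imports Defs
begin

text \<open>
  Since \<open>J\<^sup>T = - J\<close>, a tensor \<open>A\<close> is Hamiltonian iff \<open>J A\<close> is supersymmetric. A supersymmetric
  \<open>B\<close> of order \<open>j\<close> satisfies \<open>\<nabla>(B x\<^sup>j) = j B x\<^sup>j\<^sup>-\<^sup>1\<close>, so for Hamiltonian \<open>A\<^sub>j\<close> one takes
  \<open>B\<^sub>j = - J A\<^sub>j / j\<close>. Conversely, a Hamiltonian of the required form gives
  \<open>\<Sum>\<^sub>j (J A\<^sub>j + j B\<^sub>j) x\<^sup>j\<^sup>-\<^sup>1 = 0\<close> for all \<open>x\<close>. Each homogeneous part vanishes, and a symmetric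
  tensor is determined by its form, so semi-symmetry yields \<open>J A\<^sub>j = - j B\<^sub>j\<close>.
\<close>

section \<open>Symmetry of tensors in terms of multi-indices\<close>

text \<open>Lists with the same multiset are permutations of each other. Without explicit
  permutations, fixing the first index or swapping two indices becomes immediate.\<close>

lemma supersymmetric_iff_mset:
  "supersymmetric k A \<longleftrightarrow> (\<forall>is js. length is = k \<longrightarrow> mset is = mset js \<longrightarrow> A is = A js)"
proof
  assume A: "supersymmetric k A"
  show "\<forall>is js. length is = k \<longrightarrow> mset is = mset js \<longrightarrow> A is = A js"
  proof (intro allI impI)
    fix "is" js :: "'a list"
    assume len: "length is = k" and eq: "mset is = mset js"
    obtain p where "p permutes {..<length is}" "permute_list p is = js"
      using mset_eq_permutation[OF eq[symmetric]] by blast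
    then show "A is = A js"
      using A len unfolding supersymmetric_def by metis
  qed
next
  assume "\<forall>is js. length is = k \<longrightarrow> mset is = mset js \<longrightarrow> A is = A js"
  then show "supersymmetric k A"
    unfolding supersymmetric_def by (metis mset_permute_list)
qed

lemma supersymmetric_Cons:
  assumes "supersymmetric (Suc k) A"
  shows "supersymmetric k (\<lambda>js. A (i # js))"
  using assms unfolding supersymmetric_iff_mset by simp

text \<open>Fixing the first index gives slices of order \<open>k\<close>, to which facts about
  supersymmetric tensors apply.\<close>

lemma semi_symmetric_iff:
  "semi_symmetric (Suc k) A \<longleftrightarrow> (\<forall>i. supersymmetric k (\<lambda>js. A (i # js)))"
  unfolding semi_symmetric_def supersymmetric_def by auto

section \<open>Forms, their gradients and their homogeneous parts\<close>

lemma tensor_form_0: "tensor_form 0 A x = A []"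
  by (simp add: tensor_form_def)

text \<open>Splitting a multi-index into head and tail gives the recursion behind the inductions on
  the order.\<close>

lemma tensor_form_Suc:
  "tensor_form (Suc k) A x = (\<Sum>i\<in>UNIV. x $ i * tensor_form k (\<lambda>js. A (i # js)) x)"
proof -
  have "tensor_form (Suc k) A x =
      (\<Sum>(i, js)\<in>UNIV \<times> {js. length js = k}. A (i # js) * (\<Prod>j\<leftarrow>i # js. x $ j))"
    unfolding tensor_form_def
    by (rule sum.reindex_bij_witness[where i = "\<lambda>(i, js). i # js" and j = "\<lambda>is. (hd is, tl is)"])
      (auto simp: length_Suc_conv)
  also have "\<dots> = (\<Sum>i\<in>UNIV. x $ i * tensor_form k (\<lambda>js. A (i # js)) x)"
    by (simp add: sum.cartesian_product[symmetric] tensor_form_def sum_distrib_left mult_ac)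
  finally show ?thesis .
qed

lemma tensor_vec_nth: "tensor_vec (Suc k) A x $ i = tensor_form k (\<lambda>js. A (i # js)) x"
  by (simp add: tensor_vec_def tensor_form_def)

lemma tensor_form_scaleR: "tensor_form k A (t *\<^sub>R x) = t ^ k * tensor_form k A x"
  by (induction k arbitrary: A) (simp_all add: tensor_form_0 tensor_form_Suc sum_distrib_left mult_ac)

lemma tensor_vec_add_scale:
  "tensor_vec k (\<lambda>is. A is + c * B is) x = tensor_vec k A x + c *\<^sub>R tensor_vec k B x"
  by (simp add: vec_eq_iff tensor_vec_def sum.distrib sum_distrib_left algebra_simps)

text \<open>In the product rule for the recursion, the split-off index yields the contraction once.
  By induction the slices yield \<open>k\<close> further terms, which symmetry identifies with the
  same contraction.\<close>

lemma has_derivative_tensor_form: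
  assumes "supersymmetric k A"
  shows "(tensor_form k A has_derivative (\<lambda>h. h \<bullet> (of_nat k *\<^sub>R tensor_vec k A x))) (at x)"
  using assms
proof (induction k arbitrary: A)
  case 0
  have "tensor_form 0 A = (\<lambda>_. A [])"
    by (simp add: fun_eq_iff tensor_form_0)
  then show ?case by simp
next
  case (Suc k)
  let ?A = "\<lambda>i js. A (i # js)"
  have eq: "tensor_form (Suc k) A = (\<lambda>x. \<Sum>i\<in>UNIV. x $ i * tensor_form k (?A i) x)"
    by (simp add: fun_eq_iff tensor_form_Suc)
  have IH: "(tensor_form k (?A i) has_derivative
      (\<lambda>h. h \<bullet> (of_nat k *\<^sub>R tensor_vec k (?A i) x))) (at x)" for i
    by (rule Suc.IH[OF supersymmetric_Cons[OF Suc.prems]])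
  have comp: "((\<lambda>x. x $ i) has_derivative (\<lambda>h. h $ i)) (at x)" for i
    by (rule bounded_linear_imp_has_derivative) (rule bounded_linear_vec_nth)
  have D: "(tensor_form (Suc k) A has_derivative
     (\<lambda>h. \<Sum>i\<in>UNIV. x $ i * (h \<bullet> (of_nat k *\<^sub>R tensor_vec k (?A i) x)) + h $ i * tensor_form k (?A i) x)) (at x)"
    unfolding eq by (intro has_derivative_sum has_derivative_mult comp IH)
  \<comment> \<open>Two indices are split off, so that the symmetry swaps \<open>h\<close> and \<open>x\<close>.\<close>
  have swap: "of_nat k * (\<Sum>i\<in>UNIV. x $ i * (h \<bullet> tensor_vec k (?A i) x)) =
      of_nat k * (h \<bullet> tensor_vec (Suc k) A x)" for h
  \<comment> \<open>The factor \<open>of_nat k\<close> settles \<open>k = 0\<close>: there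
    \<open>tensor_vec k\<close> reads lists of length 1, because \<open>0 - 1 = 0\<close> on
    naturals.\<close>
  proof (cases k)
    case (Suc m)
    have sym: "tensor_form m (\<lambda>js. A (i # l # js)) x = tensor_form m (\<lambda>js. A (l # i # js)) x" for i l
      unfolding tensor_form_def
    proof (intro sum.cong refl)
      fix js :: "'a list" assume "js \<in> {js. length js = m}"
      then have "A (i # l # js) = A (l # i # js)"
        using Suc.prems \<open>k = Suc m\<close> unfolding supersymmetric_iff_mset by (simp add: add_mset_commute)
      then show "A (i # l # js) * (\<Prod>j\<leftarrow>js. x $ j) = A (l # i # js) * (\<Prod>j\<leftarrow>js. x $ j)" by simp
    qed
    have "(\<Sum>i\<in>UNIV. x $ i * (h \<bullet> tensor_vec k (?A i) x)) =
        (\<Sum>i\<in>UNIV. \<Sum>l\<in>UNIV. x $ i * (h $ l * tensor_form m (\<lambda>js. A (i # l # js)) x))"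
      by (simp add: Suc inner_vec_def tensor_vec_nth sum_distrib_left)
    also have "\<dots> = (\<Sum>l\<in>UNIV. \<Sum>i\<in>UNIV. x $ i * (h $ l * tensor_form m (\<lambda>js. A (l # i # js)) x))"
      by (subst sum.swap) (simp add: sym)
    also have "\<dots> = h \<bullet> tensor_vec (Suc k) A x"
      by (simp add: Suc inner_vec_def tensor_vec_nth tensor_form_Suc sum_distrib_left mult_ac)
    finally show ?thesis by simp
  qed simp
  have "(\<Sum>i\<in>UNIV. x $ i * (h \<bullet> (of_nat k *\<^sub>R tensor_vec k (?A i) x)) + h $ i * tensor_form k (?A i) x)
      = h \<bullet> (of_nat (Suc k) *\<^sub>R tensor_vec (Suc k) A x)" for h
  proof -
    have "(\<Sum>i\<in>UNIV. x $ i * (h \<bullet> (of_nat k *\<^sub>R tensor_vec k (?A i) x)) + h $ i * tensor_form k (?A i) x)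
      = of_nat k * (\<Sum>i\<in>UNIV. x $ i * (h \<bullet> tensor_vec k (?A i) x)) + h \<bullet> tensor_vec (Suc k) A x"
      by (simp add: sum.distrib sum_distrib_left mult_ac inner_vec_def[of h "tensor_vec (Suc k) A x"]
          tensor_vec_nth)
    then show ?thesis unfolding swap by (simp add: algebra_simps)
  qed
  then show ?case using D by simp
qed

text \<open>A zero form has zero gradient. By symmetry the gradient is a multiple of the
  contraction, whose entries are the forms of the slices, so induction on the order applies.\<close>

lemma supersymmetric_eq_0:
  assumes "supersymmetric k A" and "\<And>x. tensor_form k A x = 0" and "length is = k"
  shows "A is = 0"
  using assms
proof (induction k arbitrary: A "is")
  case 0
  then show ?case by (simp add: tensor_form_0)
next
  case (Suc k)
  obtain i js where "is": "is = i # js" "length js = k"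
    using Suc.prems(3) by (auto simp: length_Suc_conv)
  have "tensor_vec (Suc k) A x = 0" for x
  proof -
    have "(tensor_form (Suc k) A has_derivative (\<lambda>h. 0)) (at x)"
      using Suc.prems(2) by (simp add: ext[of "tensor_form (Suc k) A" "\<lambda>_. 0"])
    then have "(\<lambda>h. h \<bullet> (of_nat (Suc k) *\<^sub>R tensor_vec (Suc k) A x)) = (\<lambda>h. 0)"
      using has_derivative_tensor_form[OF Suc.prems(1)] has_derivative_unique by blast
    \<comment> \<open>The vanishing functional is evaluated at the very vector that represents
      it.\<close>
    then have "of_nat (Suc k) *\<^sub>R tensor_vec (Suc k) A x = 0"
      by (metis inner_eq_zero_iff)
    then show ?thesis by simp
  qed
  then have "tensor_form k (\<lambda>js. A (i # js)) x = 0" for x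
    by (metis tensor_vec_nth zero_index)
  then show ?case
    using Suc.IH[OF supersymmetric_Cons[OF Suc.prems(1)]] "is" by blast
qed

text \<open>Along the ray \<open>t *\<^sub>R x\<close> the sum is a polynomial in \<open>t\<close>
  whose coefficients are the homogeneous parts at \<open>x\<close>.\<close>

lemma tensor_vec_homogeneous_parts_eq_0:
  fixes D :: "nat \<Rightarrow> 'n::finite tensor"
  assumes "\<And>x. (\<Sum>j=2..k. tensor_vec j (D j) x) = 0" and "j \<in> {2..k}"
  shows "tensor_vec j (D j) x = 0"
proof -
  have "tensor_vec j (D j) x $ i = 0" for i
  proof -
    \<comment> \<open>The part of order \<open>j\<close> has degree \<open>j - 1\<close>. An extra
      factor \<open>t\<close> pairs it with \<open>t ^ j\<close>, and the coefficients 0 and 1 are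
      filled with zeros.\<close>
    define c where "c j = (if 2 \<le> j then tensor_vec j (D j) x $ i else 0)" for j
    have "(\<Sum>j\<le>k. c j * t ^ j) = 0" for t
    proof -
      have "(\<Sum>j\<le>k. c j * t ^ j) = (\<Sum>j=2..k. tensor_vec j (D j) x $ i * t ^ j)"
        by (rule sum.mono_neutral_cong_right) (auto simp: c_def)
      also have "\<dots> = (\<Sum>j=2..k. t * tensor_vec j (D j) (t *\<^sub>R x) $ i)"
      proof (intro sum.cong refl)
        fix j assume "j \<in> {2..k}"
        then obtain m where "j = Suc m" by (cases j) auto
        then show "tensor_vec j (D j) x $ i * t ^ j = t * tensor_vec j (D j) (t *\<^sub>R x) $ i"
          by (simp add: tensor_vec_nth tensor_form_scaleR)
      qed
      also have "\<dots> = t * (\<Sum>j=2..k. tensor_vec j (D j) (t *\<^sub>R x)) $ i"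
        by (simp add: sum_distrib_left)
      finally show ?thesis by (simp only: assms(1)) simp
    qed
    then have "c j = 0"
      using polyfun_eq_0[of c k] assms(2) by auto
    then show ?thesis using assms(2) by (simp add: c_def)
  qed
  then show ?thesis by (simp add: vec_eq_iff)
qed

section \<open>Matrices acting on tensors, and the symplectic matrix\<close>

lemma mat_tensor_Cons: "mat_tensor R A (i # js) = (\<Sum>j\<in>UNIV. R $ i $ j * A (j # js))"
  by (simp add: mat_tensor_def)

lemma tensor_vec_mat_tensor: "tensor_vec k (mat_tensor R A) x = R *v tensor_vec k A x"
proof -
  have "(\<Sum>js | length js = k - 1. (\<Sum>j\<in>UNIV. R $ i $ j * A (j # js)) * (\<Prod>j\<leftarrow>js. x $ j)) =
      (\<Sum>j\<in>UNIV. R $ i $ j * (\<Sum>js | length js = k - 1. A (j # js) * (\<Prod>j\<leftarrow>js. x $ j)))" for i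
    unfolding sum_distrib_left sum_distrib_right by (subst sum.swap) (simp add: mult_ac)
  then show ?thesis
    by (simp add: vec_eq_iff tensor_vec_def matrix_vector_mult_def mat_tensor_Cons)
qed

lemma semi_symmetric_mat_tensor:
  assumes "semi_symmetric k A"
  shows "semi_symmetric k (mat_tensor R A)"
  using assms unfolding semi_symmetric_def mat_tensor_Cons by simp

lemma transpose_symplectic_J: "transpose symplectic_J = - symplectic_J"
  by (auto simp: vec_eq_iff transpose_def symplectic_J_def mat_def split: sum.split)

lemma symplectic_J_squared:
  fixes v :: "real^('m::finite + 'm)"
  shows "symplectic_J *v (symplectic_J *v v) = - v"
proof -
  let ?J = "symplectic_J :: real^('m + 'm)^('m + 'm)"
  have UNIV_sum: "(\<Sum>j\<in>UNIV. f j) = (\<Sum>a\<in>UNIV. f (Inl a)) + (\<Sum>b\<in>UNIV. f (Inr b))"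
    for f :: "'m + 'm \<Rightarrow> real"
    unfolding UNIV_Plus_UNIV[symmetric] by (subst sum.Plus) auto
  have delta: "(\<Sum>b\<in>UNIV. (if a = b then 1 else 0) * g b) = g a" for a :: 'm and g :: "'m \<Rightarrow> real"
    by (simp add: if_distrib[of "\<lambda>r. r * _"] cong: if_cong)
  have "(?J *v w) $ Inl a = w $ Inr a" "(?J *v w) $ Inr a = - w $ Inl a" for w a
    by (simp_all add: matrix_vector_mult_def UNIV_sum symplectic_J_def mat_def sum_negf delta)
  then have "(?J *v (?J *v v)) $ i = (- v) $ i" for i
    by (cases i) simp_all
  then show ?thesis by (simp add: vec_eq_iff)
qed

text \<open>The sign in the transpose of \<open>symplectic_J\<close> turns the defining equation
  into invariance under \<open>inv \<sigma>\<close>. Inversion is a bijection on permutations, so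
  this is invariance under all of them.\<close>

lemma hamiltonian_tensor_iff:
  assumes "2 \<le> k"
  shows "hamiltonian_tensor k A \<longleftrightarrow> supersymmetric k (mat_tensor symplectic_J A)"
proof -
  let ?C = "mat_tensor symplectic_J A"
  have neg: "mat_tensor (transpose symplectic_J) A is = - ?C is" for "is"
    by (simp add: transpose_symplectic_J mat_tensor_def sum_negf)
  have "hamiltonian_tensor k A \<longleftrightarrow>
      (\<forall>\<sigma>. \<sigma> permutes {..<k} \<longrightarrow> (\<forall>is. length is = k \<longrightarrow> ?C (permute_list (inv \<sigma>) is) = ?C is))"
    using assms by (simp add: hamiltonian_tensor_def tensor_transpose_def neg neg_eq_iff_add_eq_0[symmetric]
        eq_commute[of "?C _" "?C (permute_list _ _)"])
  also have "\<dots> \<longleftrightarrow> supersymmetric k ?C"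
  proof
    assume C: "\<forall>\<sigma>. \<sigma> permutes {..<k} \<longrightarrow>
      (\<forall>is. length is = k \<longrightarrow> ?C (permute_list (inv \<sigma>) is) = ?C is)"
    show "supersymmetric k ?C"
      unfolding supersymmetric_def
    proof (intro allI impI)
      fix \<sigma> and "is" :: "('a + 'a) list"
      assume "\<sigma> permutes {..<k}" "length is = k"
      then show "?C (permute_list \<sigma> is) = ?C is"
        using C[rule_format, OF permutes_inv, of \<sigma> "is"] by (simp add: permutes_inv_inv)
    qed
  next
    assume "supersymmetric k ?C"
    then show "\<forall>\<sigma>. \<sigma> permutes {..<k} \<longrightarrow>
      (\<forall>is. length is = k \<longrightarrow> ?C (permute_list (inv \<sigma>) is) = ?C is)"
      by (simp add: supersymmetric_def permutes_inv)
  qed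
  finally show ?thesis .
qed

section \<open>Hamiltonian systems with polynomial Hamiltonians\<close>

text \<open>This lets the existentially quantified gradient in \<open>hamiltonian_system\<close> be
  replaced by an explicit one.\<close>

lemma GDERIV_unique:
  assumes "GDERIV f x :> g" and "GDERIV f x :> g'"
  shows "g = g'"
proof -
  have "(\<lambda>h. h \<bullet> g) = (\<lambda>h. h \<bullet> g')"
    using assms has_derivative_unique unfolding gderiv_def by blast
  then show ?thesis by (simp add: fun_eq_iff vector_eq_ldot)
qed

lemma GDERIV_tensor_polynomial:
  assumes "\<And>j. j \<in> J \<Longrightarrow> supersymmetric j (B j)"
  shows "GDERIV (\<lambda>x. \<Sum>j\<in>J. tensor_form j (B j) x) x :> (\<Sum>j\<in>J. of_nat j *\<^sub>R tensor_vec j (B j) x)"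
  unfolding gderiv_def inner_sum_right
  by (intro has_derivative_sum has_derivative_tensor_form assms)

text \<open>Applying \<open>symplectic_J\<close>, whose square is minus the identity, moves it from
  the gradient to the vector field. The equation then merges into one tensor per order.\<close>

lemma hamiltonian_system_tensor_iff:
  fixes A B :: "nat \<Rightarrow> ('m::finite + 'm) tensor"
  assumes "\<And>j. j \<in> S \<Longrightarrow> supersymmetric j (B j)"
  shows "hamiltonian_system (\<lambda>x. \<Sum>j\<in>S. tensor_vec j (A j) x) (\<lambda>x. \<Sum>j\<in>S. tensor_form j (B j) x) \<longleftrightarrow>
    (\<forall>x. (\<Sum>j\<in>S. tensor_vec j (\<lambda>is. mat_tensor symplectic_J (A j) is + of_nat j * B j is) x) = 0)"
proof -
  let ?J = "symplectic_J :: real^('m + 'm)^('m + 'm)"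
  have grad: "(\<exists>g. GDERIV (\<lambda>x. \<Sum>j\<in>S. tensor_form j (B j) x) x :> g \<and> P g) \<longleftrightarrow>
      P (\<Sum>j\<in>S. of_nat j *\<^sub>R tensor_vec j (B j) x)" for x P
    using GDERIV_tensor_polynomial[of S B x, OF assms] GDERIV_unique by blast
  have J_sum: "(\<Sum>j\<in>S. tensor_vec j (\<lambda>is. mat_tensor ?J (A j) is + of_nat j * B j is) x) =
      ?J *v (\<Sum>j\<in>S. tensor_vec j (A j) x) + (\<Sum>j\<in>S. of_nat j *\<^sub>R tensor_vec j (B j) x)" for x
    by (simp add: tensor_vec_add_scale tensor_vec_mat_tensor sum.distrib
        linear_sum[OF matrix_vector_mul_linear])
  have J_eq: "v = ?J *v w \<longleftrightarrow> ?J *v v + w = 0" for v w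
  proof
    assume "v = ?J *v w"
    then show "?J *v v + w = 0" by (simp add: symplectic_J_squared)
  next
    assume "?J *v v + w = 0"
    then have "w = - (?J *v v)" by (simp add: eq_neg_iff_add_eq_0 add.commute)
    then have "?J *v w = - (?J *v (?J *v v))"
      by (simp add: linear_neg[OF matrix_vector_mul_linear])
    then show "v = ?J *v w" by (simp add: symplectic_J_squared)
  qed
  show ?thesis unfolding hamiltonian_system_def grad J_sum J_eq ..
qed

theorem theorem2:
  fixes k :: nat and A :: "nat \<Rightarrow> ('m::finite + 'm) tensor"
  assumes "k \<ge> 2"
  shows "((\<forall>j\<in>{2..k}. hamiltonian_tensor j (A j)) \<longrightarrow> has_tensor_hamiltonian k A) \<and>
    ((\<forall>j\<in>{2..k}. semi_symmetric j (A j)) \<longrightarrow>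
      (has_tensor_hamiltonian k A \<longleftrightarrow> (\<forall>j\<in>{2..k}. hamiltonian_tensor j (A j))))"
proof -
  have if_direction: "has_tensor_hamiltonian k A" if A: "\<forall>j\<in>{2..k}. hamiltonian_tensor j (A j)"
  proof -
    \<comment> \<open>The division cancels the factor \<open>of_nat j\<close> produced by
      differentiation.\<close>
    define B where "B j is = - (1 / of_nat j) * mat_tensor symplectic_J (A j) is" for j "is"
    have B: "supersymmetric j (B j)" if "j \<in> {2..k}" for j
      using A that hamiltonian_tensor_iff[of j "A j"] by (auto simp: supersymmetric_def B_def)
    have "tensor_vec j (\<lambda>is. mat_tensor symplectic_J (A j) is + of_nat j * B j is) x = 0"
      if "j \<in> {2..k}" for j x
      using that by (simp add: B_def tensor_vec_def vec_eq_iff)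
    then have "hamiltonian_system (\<lambda>x. \<Sum>j=2..k. tensor_vec j (A j) x)
        (\<lambda>x. \<Sum>j=2..k. tensor_form j (B j) x)"
      using B by (subst hamiltonian_system_tensor_iff) auto
    then show ?thesis
      unfolding has_tensor_hamiltonian_def using B by blast
  qed
  moreover have "hamiltonian_tensor j (A j)"
    if A: "\<forall>j\<in>{2..k}. semi_symmetric j (A j)" and H: "has_tensor_hamiltonian k A" and j: "j \<in> {2..k}"
    for j
  proof -
    obtain B where B: "\<forall>j\<in>{2..k}. supersymmetric j (B j)"
      and sys: "hamiltonian_system (\<lambda>x. \<Sum>j=2..k. tensor_vec j (A j) x)
        (\<lambda>x. \<Sum>j=2..k. tensor_form j (B j) x)"
      using H unfolding has_tensor_hamiltonian_def by blast
    let ?C = "mat_tensor symplectic_J (A j)"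
    let ?D = "\<lambda>is. ?C is + of_nat j * B j is"
    obtain m where m: "j = Suc m" using j by (cases j) auto
    have "tensor_vec j ?D x = 0" for x
      using sys hamiltonian_system_tensor_iff[of "{2..k}" B A] B j
        tensor_vec_homogeneous_parts_eq_0[of
          "\<lambda>j is. mat_tensor symplectic_J (A j) is + of_nat j * B j is" k j x]
      by blast
    then have form: "tensor_form m (\<lambda>js. ?D (i # js)) x = 0" for i x
      using tensor_vec_nth[of m ?D x i] m by simp
    \<comment> \<open>The matrix acts on the first index only, so the semi-symmetry of
      \<open>A j\<close> survives. It makes the slices of \<open>?D\<close> supersymmetric, hence
      determined by their forms.\<close>
    have "supersymmetric m (\<lambda>js. ?C (i # js))" for i
      using semi_symmetric_mat_tensor[of j "A j" symplectic_J] A j semi_symmetric_iff[of m ?C] m by simp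
    moreover have "supersymmetric m (\<lambda>js. B j (i # js))" for i
      using B j m supersymmetric_Cons[of m "B j"] by auto
    ultimately have "supersymmetric m (\<lambda>js. ?D (i # js))" for i
      unfolding supersymmetric_def by simp
    then have "?D (i # js) = 0" if "length js = m" for i js
      using supersymmetric_eq_0[of m "\<lambda>js. ?D (i # js)" js] form that by simp
    then have "?D is = 0" if "length is = j" for "is"
      using that unfolding m length_Suc_conv by blast
    then have "?C is = - of_nat j * B j is" if "length is = j" for "is"
      using that by (simp only: eq_neg_iff_add_eq_0 mult_minus_left)
    \<comment> \<open>Symmetry involving the first index is inherited from
      \<open>B j\<close>.\<close>
    then have "supersymmetric j ?C"
      using B j unfolding supersymmetric_def by simp
    then show ?thesis
      using hamiltonian_tensor_iff j by auto
  qed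
  ultimately show ?thesis by blast
qed

end
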